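(* Let $H$ be a real, separable Hilbert space and let $f\colon H\to\mathbb{R}$ be a continuously differentiable convex function. If the gradient of $f$ has constant norm, i.e. there is a real constant $k\ge 0$ such that $|\nabla_u f|=k$ for all $u\in H$, then $f$ is an affine mapping, i.e. there exist $c_1\in H$ and $c_0\in\mathbb{R}$ such that $f(u)=\langle c_1,u\rangle+c_0$ for all $u\in H$.
   Context: $\langle\cdot,\cdot\rangle$ and $|\cdot|$ denote the inner product and the norm of $H$. Continuously differentiable means Fréchet differentiable at every point with the derivative depending continuously (in norm) on the point. The gradient $\nabla_u f\in H$ at $u\in H$ is the vector representing the derivative of $f$ at $u$ via the inner product (Riesz representation). *)

theory Defs
  imports "HOL-Analysis.Analysis"
begin

definition continuously_differentiable :: "('a::real_normed_vector \<Rightarrow> real) \<Rightarrow> bool" where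
  "continuously_differentiable f \<longleftrightarrow>
     (\<exists>f' :: 'a \<Rightarrow> 'a \<Rightarrow>\<^sub>L real.
        (\<forall>u. (f has_derivative blinfun_apply (f' u)) (at u)) \<and> continuous_on UNIV f')"

(* On a complete space the description is proper wherever f is differentiable: existence is the
   Riesz representation theorem, uniqueness is the lemma below. *)
definition gradient :: "('a::real_inner \<Rightarrow> real) \<Rightarrow> 'a \<Rightarrow> 'a" where
  "gradient f u = (THE D. GDERIV f u :> D)"

lemma gradient_eqI:
  assumes "GDERIV f u :> D"
  shows "gradient f u = D"
  unfolding gradient_def
proof (rule the_equality)
  fix E assume "GDERIV f u :> E"
  with assms have "(\<lambda>h. inner h E) = (\<lambda>h. inner h D)"
    unfolding gderiv_def using has_derivative_unique by blast
  then have "inner (E - D) (E - D) = 0"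
    by (metis inner_diff_right diff_self)
  then show "E = D" by simp
qed (fact assms)

end

theory Submission
  imports Defs
begin

text \<open>
  Write \<open>g\<close> for the gradient, of constant norm \<open>k\<close>. For \<open>t > 0\<close> and \<open>u = v + t g(v)\<close>, adding the
  tangent inequalities at \<open>u\<close> and \<open>v\<close> gives \<open>k\<^sup>2 \<le> \<langle>g(u), g(v)\<rangle>\<close>, so \<open>g(u) = g(v)\<close>.
  Conversely every \<open>u\<close> has the form \<open>v + t g(v)\<close>: take for \<open>v\<close> the minimiser of
  \<open>f(x) + |x - u|\<^sup>2 / (2t)\<close>. Hence \<open>g\<close> takes the value \<open>g(u)\<close> on the whole backward ray
  \<open>u - t g(u)\<close>. Monotonicity of \<open>g\<close> between \<open>w\<close> and this ray reads
  \<open>\<langle>g(w) - g(u), w - u\<rangle> + t (\<langle>g(w), g(u)\<rangle> - k\<^sup>2) \<ge> 0\<close>, and \<open>t \<rightarrow> \<infinity>\<close> forces \<open>g(w) = g(u)\<close>.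
\<close>

text \<open>Restricting \<open>f\<close> to the line through \<open>u\<close> and \<open>x\<close>
  reduces this to the tangent inequality for convex functions of one real variable.\<close>

lemma convex_on_imp_above_tangent_derivative:
  fixes f :: "'a::real_normed_vector \<Rightarrow> real"
  assumes convex: "convex_on UNIV f" and deriv: "(f has_derivative L) (at u)"
  shows "f u + L (x - u) \<le> f x"
proof -
  define g where "g t = f (u + t *\<^sub>R (x - u))" for t
  interpret L: bounded_linear L
    using deriv by (rule has_derivative_bounded_linear)
  have "convex_on UNIV g"
  proof (rule convex_onI)
    fix t a b :: real assume "0 < t" "t < 1"
    have "u + ((1 - t) *\<^sub>R a + t *\<^sub>R b) *\<^sub>R (x - u)
        = (1 - t) *\<^sub>R (u + a *\<^sub>R (x - u)) + t *\<^sub>R (u + b *\<^sub>R (x - u))"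
      by (simp add: algebra_simps)
    then show "g ((1 - t) *\<^sub>R a + t *\<^sub>R b) \<le> (1 - t) * g a + t * g b"
      unfolding g_def using convex_onD[OF convex, of t] \<open>0 < t\<close> \<open>t < 1\<close> by simp
  qed simp
  moreover have "(g has_real_derivative L (x - u)) (at 0)"
  proof -
    have "((\<lambda>t::real. u + t *\<^sub>R (x - u)) has_derivative (\<lambda>t. t *\<^sub>R (x - u))) (at 0)"
      by (auto intro!: derivative_eq_intros)
    moreover have "(f has_derivative L) (at (u + 0 *\<^sub>R (x - u)))"
      using deriv by simp
    ultimately have "(g has_derivative (\<lambda>t. L (t *\<^sub>R (x - u)))) (at 0)"
      unfolding g_def by (rule has_derivative_compose)
    moreover have "(\<lambda>t. L (t *\<^sub>R (x - u))) = (*) (L (x - u))"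
      by (rule ext) (simp only: L.scaleR real_scaleR_def mult.commute)
    ultimately show ?thesis by (simp only: has_field_derivative_def)
  qed
  ultimately have "L (x - u) * (1 - 0) \<le> g 1 - g 0"
    by (intro convex_on_imp_above_tangent) auto
  then show ?thesis by (simp add: g_def)
qed

text \<open>The quadratic term makes the objective strongly convex, so every minimising sequence is
  Cauchy; completeness stands in for compactness.\<close>

lemma convex_prox_minimiser_exists:
  fixes f :: "'a::{real_inner, complete_space} \<Rightarrow> real"
  assumes convex: "convex_on UNIV f" and cont: "continuous_on UNIV f" and c: "c > 0"
    and bdd: "bdd_below (range (\<lambda>x. f x + c * (norm (x - u))\<^sup>2))"
  obtains v where "\<And>x. f v + c * (norm (v - u))\<^sup>2 \<le> f x + c * (norm (x - u))\<^sup>2"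
proof -
  define h where "h x = f x + c * (norm (x - u))\<^sup>2" for x
  define m where "m = (INF x. h x)"
  have m_le: "m \<le> h x" for x
    unfolding m_def using bdd by (intro cINF_lower) (auto simp: h_def)
  \<comment> \<open>Compare \<open>m\<close> with the value of \<open>h\<close> at the midpoint
    \<open>z\<close>; the parallelogram identity supplies the gain in
    \<open>norm (x - y)\<close>.\<close>
  have near: "c / 2 * (norm (x - y))\<^sup>2 \<le> (h x - m) + (h y - m)" for x y
  proof -
    define z where "z = (1 / 2) *\<^sub>R x + (1 / 2) *\<^sub>R y"
    have "f z \<le> f x / 2 + f y / 2"
      using convex_onD[OF convex, of "1/2" x y] by (simp add: z_def)
    moreover have "(norm (z - u))\<^sup>2
        = (norm (x - u))\<^sup>2 / 2 + (norm (y - u))\<^sup>2 / 2 - (norm (x - y))\<^sup>2 / 4"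
      unfolding z_def power2_norm_eq_inner
      by (simp add: inner_simps inner_commute field_simps)
    then have "c * (norm (z - u))\<^sup>2
        = c * (norm (x - u))\<^sup>2 / 2 + c * (norm (y - u))\<^sup>2 / 2 - c / 4 * (norm (x - y))\<^sup>2"
      by (simp only: right_diff_distrib distrib_left)
    ultimately have "h z \<le> h x / 2 + h y / 2 - c / 4 * (norm (x - y))\<^sup>2"
      unfolding h_def by argo
    with m_le[of z] show ?thesis by simp
  qed
  have "\<exists>x. h x < m + inverse (real (Suc n))" for n
    using cINF_less_iff[of UNIV h "m + inverse (real (Suc n))"] bdd
    by (auto simp: m_def h_def)
  then obtain X where X: "h (X n) < m + inverse (real (Suc n))" for n
    by metis
  have "Cauchy X"
  proof (rule CauchyI)
    fix e :: real assume "e > 0"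
    \<comment> \<open>Two errors below this threshold add up to the bound
      \<open>c / 2 * e\<^sup>2\<close> wanted in \<open>near\<close>.\<close>
    then have "c * e\<^sup>2 / 4 > 0" using c by simp
    then obtain N where N: "inverse (real (Suc N)) < c * e\<^sup>2 / 4"
      using reals_Archimedean by blast
    have small: "h (X n) - m < c * e\<^sup>2 / 4" if "n \<ge> N" for n
    proof -
      have "inverse (real (Suc n)) \<le> inverse (real (Suc N))"
        using that by (intro le_imp_inverse_le) auto
      with X[of n] N show ?thesis by linarith
    qed
    have "norm (X i - X j) < e" if "i \<ge> N" "j \<ge> N" for i j
    proof -
      have "c / 2 * (norm (X i - X j))\<^sup>2 < c / 2 * e\<^sup>2"
        using near[of "X i" "X j"] small[OF that(1)] small[OF that(2)] by linarith
      then have "(norm (X i - X j))\<^sup>2 < e\<^sup>2" using c by simp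
      then show ?thesis using \<open>e > 0\<close> by (simp add: power_less_imp_less_base)
    qed
    then show "\<exists>M. \<forall>i\<ge>M. \<forall>j\<ge>M. norm (X i - X j) < e" by blast
  qed
  then obtain v where v: "X \<longlonglongrightarrow> v"
    using Cauchy_convergent convergentD by blast
  have "continuous_on UNIV h"
    unfolding h_def by (intro continuous_intros cont)
  then have "(\<lambda>n. h (X n)) \<longlonglongrightarrow> h v"
    using v by (auto simp: continuous_on_eq_continuous_at intro: isCont_tendsto_compose)
  moreover have "(\<lambda>n. m + inverse (real (Suc n))) \<longlonglongrightarrow> m + 0"
    by (intro tendsto_intros LIMSEQ_inverse_real_of_nat)
  ultimately have "h v \<le> m + 0"
    by (rule LIMSEQ_le) (use X less_imp_le in blast)
  with m_le have "h v \<le> h x" for x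
    by (metis add.right_neutral order_trans)
  then show thesis unfolding h_def by (rule that)
qed

text \<open>This is the first-order condition at the minimiser \<open>v\<close>. It solves an
  equation for the derivative of \<open>f\<close> without assuming that gradients exist.\<close>

lemma convex_prox_equation:
  fixes f :: "'a::{real_inner, complete_space} \<Rightarrow> real"
  assumes convex: "convex_on UNIV f" and deriv: "\<And>x. (f has_derivative f' x) (at x)"
    and c: "c > 0"
  obtains v where "\<And>h. f' v h = inner h ((2 * c) *\<^sub>R (u - v))"
proof -
  have "bdd_below (range (\<lambda>x. f x + c * (norm (x - u))\<^sup>2))"
  proof -
    obtain M where M: "\<And>y. norm (f' u y) \<le> norm y * M"
      using bounded_linear.bounded[OF has_derivative_bounded_linear[OF deriv[of u]]] by blast
    \<comment> \<open>The tangent at \<open>u\<close> falls at most at rate \<open>M\<close>;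
      completing the square shows that the quadratic term compensates.\<close>
    have "f u - M\<^sup>2 / (4 * c) \<le> f x + c * (norm (x - u))\<^sup>2" for x
    proof -
      have "f u - norm (x - u) * M \<le> f x"
        using convex_on_imp_above_tangent_derivative[OF convex deriv, of u x] M[of "x - u"]
        by simp
      moreover have "c * (norm (x - u))\<^sup>2 - norm (x - u) * M + M\<^sup>2 / (4 * c)
          = c * (norm (x - u) - M / (2 * c))\<^sup>2"
        using c by (simp add: field_simps power2_eq_square)
      moreover have "\<dots> \<ge> 0" using c by simp
      ultimately show ?thesis by linarith
    qed
    then show ?thesis by (rule bdd_belowI2)
  qed
  moreover have "continuous_on UNIV f"
    using has_derivative_continuous[OF deriv] by (simp add: continuous_on_eq_continuous_at)
  ultimately obtain v where v: "f v + c * (norm (v - u))\<^sup>2 \<le> f x + c * (norm (x - u))\<^sup>2" for x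
    using convex_prox_minimiser_exists[OF convex _ c] by blast
  have "((\<lambda>x. f x + c * inner (x - u) (x - u)) has_derivative
      (\<lambda>h. f' v h + c * (2 * inner h (v - u)))) (at v)"
    by (auto intro!: derivative_eq_intros deriv simp: inner_commute)
  then have "(\<lambda>h. f' v h + c * (2 * inner h (v - u))) = (\<lambda>h. 0)"
    by (rule has_derivative_local_min) (use v in \<open>simp add: power2_norm_eq_inner\<close>)
  then have "f' v h + c * (2 * inner h (v - u)) = 0" for h
    by meson
  then have "f' v h = - (c * (2 * inner h (v - u)))" for h
    by (simp add: eq_neg_iff_add_eq_0)
  then have "f' v h = inner h ((2 * c) *\<^sub>R (u - v))" for h
    by (simp add: inner_diff_right right_diff_distrib)
  with that show thesis by blast
qed

text \<open>A bounded functional is convex and is its own derivative at every point, so the prox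
  equation with \<open>c = 1\<close> and \<open>u = 0\<close> yields the representing vector
  \<open>- 2 v\<close>.\<close>

lemma riesz_representation:
  fixes L :: "'a::{real_inner, complete_space} \<Rightarrow> real"
  assumes "bounded_linear L"
  obtains D where "\<And>h. L h = inner h D"
proof -
  interpret bounded_linear L by fact
  have "convex_on UNIV L"
    by (rule convex_onI) (simp_all add: add scaleR)
  moreover have "(L has_derivative L) (at x)" for x
    by (rule bounded_linear_imp_has_derivative) fact
  ultimately show thesis
    using convex_prox_equation[of L "\<lambda>_. L" 1 0] that by (metis zero_less_one)
qed

theorem theorem2:
  fixes f :: "'a::{real_inner, complete_space} \<Rightarrow> real" and k :: real
  assumes "separable_space (euclidean :: 'a topology)"
    and "continuously_differentiable f"
    and "convex_on UNIV f"
    and "k \<ge> 0"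
    and "\<And>u. norm (gradient f u) = k"
  shows "\<exists>(c1::'a) (c0::real). \<forall>u. f u = inner c1 u + c0"
proof -
  define g where "g = gradient f"
  \<comment> \<open>Since \<open>gradient\<close> is a definite description, a representing vector
    must be produced before \<open>g\<close> can be used.\<close>
  have deriv: "(f has_derivative (\<lambda>h. inner h (g u))) (at u)" for u
  proof -
    obtain L where L: "(f has_derivative L) (at u)"
      using assms(2) unfolding continuously_differentiable_def by blast
    obtain D where "\<And>h. L h = inner h D"
      using riesz_representation[OF has_derivative_bounded_linear[OF L]] by blast
    then have "L = (\<lambda>h. inner h D)" by blast
    with L have "GDERIV f u :> D" by (simp add: gderiv_def)
    then show ?thesis using gradient_eqI by (auto simp: g_def gderiv_def)
  qed
  have tangent: "f u + inner (x - u) (g u) \<le> f x" for u x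
    using convex_on_imp_above_tangent_derivative[OF assms(3) deriv] .
  have self: "inner (g u) (g u) = k\<^sup>2" for u
    using assms(5)[of u] by (simp add: g_def power2_norm_eq_inner[symmetric])
  have eqI: "g u = g v" if "k\<^sup>2 \<le> inner (g u) (g v)" for u v
  proof -
    have "(norm (g u - g v))\<^sup>2 = k\<^sup>2 + k\<^sup>2 - 2 * inner (g u) (g v)"
      by (simp add: power2_norm_eq_inner inner_diff_left inner_diff_right self inner_commute)
    with that have "(norm (g u - g v))\<^sup>2 \<le> 0" by simp
    then show ?thesis by simp
  qed
  have forward: "g (v + t *\<^sub>R g v) = g v" if "t > 0" for v t
  proof (rule eqI)
    have "t * k\<^sup>2 \<le> t * inner (g (v + t *\<^sub>R g v)) (g v)"
      using tangent[of v "v + t *\<^sub>R g v"] tangent[of "v + t *\<^sub>R g v" v]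
      by (simp add: self inner_commute)
    then show "k\<^sup>2 \<le> inner (g (v + t *\<^sub>R g v)) (g v)" using that by simp
  qed
  have backward: "g (u - t *\<^sub>R g u) = g u" if "t > 0" for u t
  proof -
    \<comment> \<open>The weight \<open>1 / (2 * t)\<close> turns the prox equation into
      \<open>t g(v) = u - v\<close>.\<close>
    obtain v where v: "\<And>h. inner h (g v) = inner h ((2 * (1 / (2 * t))) *\<^sub>R (u - v))"
      using convex_prox_equation[OF assms(3) deriv, of "1 / (2 * t)" u] \<open>t > 0\<close> by auto
    have "g v = (1 / t) *\<^sub>R (u - v)"
      using v that by (intro vector_eq_ldot[THEN iffD1]) simp
    then have u: "u = v + t *\<^sub>R g v" using that by simp
    then have "g u = g v" using forward[OF that, of v] by simp
    with u show ?thesis by simp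
  qed
  have const: "g w = g u" for w u
  proof (rule eqI, rule ccontr)
    define d where "d = k\<^sup>2 - inner (g w) (g u)"
    define s where "s = inner (g w - g u) (w - u)"
    assume "\<not> k\<^sup>2 \<le> inner (g w) (g u)"
    then have d: "d > 0" by (simp add: d_def)
    have mono: "t * d \<le> s" if "t > 0" for t
      using tangent[of w "u - t *\<^sub>R g u"] tangent[of "u - t *\<^sub>R g u" w]
      by (simp add: backward[OF that] d_def s_def inner_simps self inner_commute algebra_simps)
    \<comment> \<open>This \<open>t\<close> is positive and makes
      \<open>t * d = \<bar>s\<bar> + d\<close>, which exceeds \<open>s\<close>.\<close>
    have "(\<bar>s\<bar> / d + 1) * d \<le> s"
      using d by (intro mono) (simp add: add_nonneg_pos)
    then have "\<bar>s\<bar> + d \<le> s" using d by (simp add: distrib_right)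
    then show False using d by linarith
  qed
  \<comment> \<open>With equal gradients, the tangent inequalities at \<open>0\<close> and at
    \<open>u\<close> bound \<open>f u\<close> from below and above by the same value.\<close>
  have "f u = inner (g 0) u + f 0" for u
    using tangent[of 0 u] tangent[of u 0] const[of u 0] by (simp add: inner_commute)
  then show ?thesis by blast
qed

end
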